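(* Let $X$ and $Y$ be real Banach spaces, let $x\in S_X$ and $y\in S_Y$, and let $p,q>1$ satisfy $1/p+1/q=1$. (a) If $x$ is a $\Delta_p$-point in $X$ and $y$ is a $\Delta_q$-point in $Y$, then $(x,y)$ is a $\Delta$-point in $X\oplus_\infty Y$. (b) If $x$ is not a $\Delta_p$-point in $X$ and $y$ is not a $\Delta_q$-point in $Y$, then $(x,y)$ is not a $\Delta$-point in $X\oplus_\infty Y$.
   Context: All Banach spaces are real. $B_X$, $S_X$ and $X^*$ denote the closed unit ball, the unit sphere and the dual space of $X$. For $x\in S_X$ and $\varepsilon>0$ put $\Delta_\varepsilon(x)=\{y\in B_X : \|x-y\|\ge 2-\varepsilon\}$. A point $x\in S_X$ is a $\Delta$-point of $X$ if $x\in\overline{\mathrm{conv}}\,\Delta_\varepsilon(x)$ for every $\varepsilon>0$. For $x^*\in S_{X^*}$ and $\alpha>0$, the corresponding slice of the unit ball is $S(B_X,x^*,\alpha)=\{y\in B_X : x^*(y)>1-\alpha\}$. For $k>1$, a point $x\in S_X$ is a $\Delta_k$-point in $X$ if for every slice $S(B_X,x^*,\alpha)$ (with $x^*\in S_{X^*}$, $\alpha>0$) such that $x\in S(B_X,x^*,\alpha)$ and for every $\varepsilon>0$ there exists $u\in S(B_X,x^*,k\alpha)$ such that $\|x-u\|\ge 2-\varepsilon$. $X\oplus_\infty Y$ is the direct sum $X\oplus Y$ with norm $\|(x,y)\|_\infty=\max\{\|x\|,\|y\|\}$. *)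

theory Defs
  imports "HOL-Analysis.Analysis"
begin

text \<open>
  The library's norm on the product type is the Euclidean one, so \<open>X \<oplus>\<^sub>\<infinity> Y\<close> needs a type of its
  own. Addition and scaling are componentwise.
\<close>

datatype ('a, 'b) linf_sum = LinfPair (lfst: 'a) (lsnd: 'b)

instantiation linf_sum :: (real_vector, real_vector) real_vector
begin

definition zero_linf_sum :: "('a, 'b) linf_sum" where
  "0 = LinfPair 0 0"

definition plus_linf_sum :: "('a, 'b) linf_sum \<Rightarrow> ('a, 'b) linf_sum \<Rightarrow> ('a, 'b) linf_sum" where
  "z + w = LinfPair (lfst z + lfst w) (lsnd z + lsnd w)"

definition minus_linf_sum :: "('a, 'b) linf_sum \<Rightarrow> ('a, 'b) linf_sum \<Rightarrow> ('a, 'b) linf_sum" where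
  "z - w = LinfPair (lfst z - lfst w) (lsnd z - lsnd w)"

definition uminus_linf_sum :: "('a, 'b) linf_sum \<Rightarrow> ('a, 'b) linf_sum" where
  "- z = LinfPair (- lfst z) (- lsnd z)"

definition scaleR_linf_sum :: "real \<Rightarrow> ('a, 'b) linf_sum \<Rightarrow> ('a, 'b) linf_sum" where
  "r *\<^sub>R z = LinfPair (r *\<^sub>R lfst z) (r *\<^sub>R lsnd z)"

instance
  by standard
    (simp_all add: zero_linf_sum_def plus_linf_sum_def minus_linf_sum_def uminus_linf_sum_def
      scaleR_linf_sum_def algebra_simps)

end

lemma lfst_simps [simp]:
  "lfst 0 = 0" "lfst (z + w) = lfst z + lfst w" "lfst (z - w) = lfst z - lfst w"
  "lfst (- z) = - lfst z" "lfst (r *\<^sub>R z) = r *\<^sub>R lfst z"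
  by (simp_all add: zero_linf_sum_def plus_linf_sum_def minus_linf_sum_def uminus_linf_sum_def
      scaleR_linf_sum_def)

lemma lsnd_simps [simp]:
  "lsnd 0 = 0" "lsnd (z + w) = lsnd z + lsnd w" "lsnd (z - w) = lsnd z - lsnd w"
  "lsnd (- z) = - lsnd z" "lsnd (r *\<^sub>R z) = r *\<^sub>R lsnd z"
  by (simp_all add: zero_linf_sum_def plus_linf_sum_def minus_linf_sum_def uminus_linf_sum_def
      scaleR_linf_sum_def)

instantiation linf_sum :: (real_normed_vector, real_normed_vector) real_normed_vector
begin

definition norm_linf_sum :: "('a, 'b) linf_sum \<Rightarrow> real" where
  "norm_linf_sum z = max (norm (lfst z)) (norm (lsnd z))"

definition dist_linf_sum :: "('a, 'b) linf_sum \<Rightarrow> ('a, 'b) linf_sum \<Rightarrow> real" where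
  "dist_linf_sum z w = norm (z - w)"

definition sgn_linf_sum :: "('a, 'b) linf_sum \<Rightarrow> ('a, 'b) linf_sum" where
  "sgn_linf_sum z = inverse (norm z) *\<^sub>R z"

definition uniformity_linf_sum :: "(('a, 'b) linf_sum \<times> ('a, 'b) linf_sum) filter" where
  "uniformity_linf_sum = (INF e\<in>{0 <..}. principal {(z, w). dist z w < e})"

definition open_linf_sum :: "('a, 'b) linf_sum set \<Rightarrow> bool" where
  "open_linf_sum U \<longleftrightarrow> (\<forall>z\<in>U. eventually (\<lambda>(z', w). z' = z \<longrightarrow> w \<in> U) uniformity)"

instance
proof
  fix z w :: "('a, 'b) linf_sum" and r :: real
  show "norm z = 0 \<longleftrightarrow> z = 0"
    by (cases z) (auto simp: norm_linf_sum_def zero_linf_sum_def max_def)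
  show "norm (z + w) \<le> norm z + norm w"
    using norm_triangle_ineq[of "lfst z" "lfst w"] norm_triangle_ineq[of "lsnd z" "lsnd w"]
    by (auto simp: norm_linf_sum_def)
  show "norm (r *\<^sub>R z) = \<bar>r\<bar> * norm z"
    by (simp add: norm_linf_sum_def max_mult_distrib_left)
qed (rule dist_linf_sum_def sgn_linf_sum_def uniformity_linf_sum_def open_linf_sum_def)+

end

lemma norm_LinfPair [simp]: "norm (LinfPair x y) = max (norm x) (norm y)"
  by (simp add: norm_linf_sum_def)

lemma norm_lfst_le: "norm (lfst z) \<le> norm z" and norm_lsnd_le: "norm (lsnd z) \<le> norm z"
  by (simp_all add: norm_linf_sum_def)

instance linf_sum :: (banach, banach) banach
proof
  fix Z :: "nat \<Rightarrow> ('a, 'b) linf_sum"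
  assume "Cauchy Z"
  then have Z: "\<And>e. e > 0 \<Longrightarrow> \<exists>M. \<forall>m\<ge>M. \<forall>n\<ge>M. norm (Z m - Z n) < e"
    by (simp add: Cauchy_iff)
  have "Cauchy (\<lambda>n. lfst (Z n))"
    unfolding Cauchy_iff using Z norm_lfst_le[of "Z _ - Z _"]
    by (metis le_less_trans lfst_simps(3))
  then obtain a where a: "(\<lambda>n. lfst (Z n)) \<longlonglongrightarrow> a"
    using Cauchy_convergent_iff convergent_def by blast
  have "Cauchy (\<lambda>n. lsnd (Z n))"
    unfolding Cauchy_iff using Z norm_lsnd_le[of "Z _ - Z _"]
    by (metis le_less_trans lsnd_simps(3))
  then obtain b where b: "(\<lambda>n. lsnd (Z n)) \<longlonglongrightarrow> b"
    using Cauchy_convergent_iff convergent_def by blast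
  have "(\<lambda>n. max (norm (lfst (Z n) - a)) (norm (lsnd (Z n) - b))) \<longlonglongrightarrow> max 0 0"
    using a b by (intro tendsto_max) (simp_all add: LIM_zero tendsto_norm_zero)
  then have "(\<lambda>n. norm (Z n - LinfPair a b)) \<longlonglongrightarrow> 0"
    by (simp add: norm_linf_sum_def)
  then have "Z \<longlonglongrightarrow> LinfPair a b"
    using LIM_zero_iff tendsto_norm_zero_iff by blast
  then show "convergent Z"
    by (rule convergentI)
qed

definition far_set :: "real \<Rightarrow> 'a::real_normed_vector \<Rightarrow> 'a set" where
  "far_set \<epsilon> x = {y \<in> cball 0 1. norm (x - y) \<ge> 2 - \<epsilon>}"

definition delta_point :: "'a::real_normed_vector \<Rightarrow> bool" where
  "delta_point x \<longleftrightarrow> x \<in> sphere 0 1 \<and> (\<forall>\<epsilon>>0. x \<in> closure (convex hull (far_set \<epsilon> x)))"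

definition ball_slice :: "('a::real_normed_vector \<Rightarrow>\<^sub>L real) \<Rightarrow> real \<Rightarrow> 'a set" where
  "ball_slice f \<alpha> = {y \<in> cball 0 1. blinfun_apply f y > 1 - \<alpha>}"

text \<open>Only meant for \<open>k > 1\<close>.\<close>

definition delta_k_point :: "real \<Rightarrow> 'a::real_normed_vector \<Rightarrow> bool" where
  "delta_k_point k x \<longleftrightarrow> x \<in> sphere 0 1 \<and>
    (\<forall>f \<in> sphere (0 :: 'a \<Rightarrow>\<^sub>L real) 1. \<forall>\<alpha>>0. x \<in> ball_slice f \<alpha> \<longrightarrow>
      (\<forall>\<epsilon>>0. \<exists>u \<in> ball_slice f (k * \<alpha>). norm (x - u) \<ge> 2 - \<epsilon>))"

end

theory Submission
  imports Defs
begin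

text \<open>
  (a) If \<open>(x, y)\<close> is not in the closed convex hull of its far set, Hahn-Banach gives a functional
  \<open>F = (f, g)\<close> of norm \<open>\<parallel>f\<parallel> + \<parallel>g\<parallel>\<close> with \<open>F (x, y)\<close> strictly above the supremum of \<open>F\<close> on
  the far set. Put \<open>A = \<parallel>f\<parallel> - f x\<close> and \<open>B = \<parallel>g\<parallel> - g y\<close>. A point \<open>(u, v)\<close> of the ball is far as
  soon as one coordinate is, so the other one may nearly attain its norm and the supremum is at
  least \<open>\<parallel>F\<parallel> - p A\<close> and \<open>\<parallel>F\<parallel> - q B\<close>. Hence \<open>A + B < p A\<close> and \<open>A + B < q B\<close>, which
  contradicts \<open>1 / p + 1 / q = 1\<close>. (b) Conversely, functionals \<open>f\<close>, \<open>g\<close> witnessing the two failures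
  are combined with weights into one functional that separates \<open>(x, y)\<close> from its far set.

  Hahn-Banach itself follows from the fact that minimal sublinear functionals are linear: if \<open>m\<close> is
  sublinear and \<open>K\<close> is a convex cone below the graph of \<open>m\<close>, then the infimum of \<open>m (z + k) - r\<close>
  over \<open>(k, r) \<in> K\<close> is again sublinear. The ray through \<open>(y, m y)\<close> yields the additivity of a
  minimal \<open>m\<close>, the cone over \<open>(z - S) \<times> {d}\<close> the separation of \<open>z\<close> from \<open>S\<close>.
\<close>

section \<open>Sublinear functionals and separation in real normed spaces\<close>

definition sublinear :: "('a::real_vector \<Rightarrow> real) \<Rightarrow> bool" where
  "sublinear m \<longleftrightarrow> (\<forall>x y. m (x + y) \<le> m x + m y) \<and> (\<forall>c\<ge>0. \<forall>x. m (c *\<^sub>R x) = c * m x)"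

lemma sublinear_add: "sublinear m \<Longrightarrow> m (x + y) \<le> m x + m y"
  and sublinear_scaleR: "sublinear m \<Longrightarrow> c \<ge> 0 \<Longrightarrow> m (c *\<^sub>R x) = c * m x"
  by (auto simp: sublinear_def)

lemma sublinear_zero: "sublinear m \<Longrightarrow> m 0 = 0"
  using sublinear_scaleR[of m 0 0] by simp

lemma sublinear_minus: "sublinear m \<Longrightarrow> - m (- x) \<le> m x"
  using sublinear_add[of m x "- x"] sublinear_zero[of m] by simp

text \<open>Infima deliver only inequalities. Applying \<open>scale\<close> to
  \<open>inverse c\<close> reverses it, and the factors 2 and 1/2 at 0 force
  \<open>m 0 = 0\<close>.\<close>

lemma sublinearI:
  assumes add: "\<And>x y. m (x + y) \<le> m x + m y"
    and scale: "\<And>c x. c > 0 \<Longrightarrow> m (c *\<^sub>R x) \<le> c * m x"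
  shows "sublinear m"
proof -
  have "m 0 \<le> 2 * m 0" "m 0 \<le> (1/2) * m 0"
    using scale[of 2 0] scale[of "1/2" 0] by simp_all
  then have zero: "m 0 = 0" by simp
  have "m (c *\<^sub>R x) = c * m x" if "c \<ge> 0" for c x
  proof (cases "c = 0")
    case False
    then have c: "c > 0" using that by simp
    have "m x \<le> inverse c * m (c *\<^sub>R x)"
      using scale[of "inverse c" "c *\<^sub>R x"] c by simp
    then have "c * m x \<le> m (c *\<^sub>R x)"
      using c by (simp add: field_simps)
    then show ?thesis
      using scale[OF c, of x] by simp
  qed (simp add: zero)
  then show ?thesis
    by (simp add: sublinear_def add)
qed

lemma sublinear_norm: "sublinear (norm :: 'a::real_normed_vector \<Rightarrow> real)"
  by (simp add: sublinear_def norm_triangle_ineq)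

section \<open>Infima of sublinear functionals and the existence of minimal ones\<close>

lemma le_cINF_add:
  fixes f :: "'a \<Rightarrow> real" and g :: "'b \<Rightarrow> real"
  assumes "A \<noteq> {}" "B \<noteq> {}" and le: "\<And>a b. a \<in> A \<Longrightarrow> b \<in> B \<Longrightarrow> l \<le> f a + g b"
  shows "l \<le> (INF a\<in>A. f a) + (INF b\<in>B. g b)"
proof -
  have "l - f a \<le> (INF b\<in>B. g b)" if "a \<in> A" for a
    using le[OF that] by (intro cINF_greatest assms) (simp add: algebra_simps)
  then have "l - (INF b\<in>B. g b) \<le> (INF a\<in>A. f a)"
    by (intro cINF_greatest assms) (simp add: algebra_simps)
  then show ?thesis by simp
qed

lemma le_mult_cINF:
  fixes f :: "'a \<Rightarrow> real"
  assumes "A \<noteq> {}" "c > 0" and "\<And>a. a \<in> A \<Longrightarrow> l \<le> c * f a"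
  shows "l \<le> c * (INF a\<in>A. f a)"
proof -
  have "l / c \<le> (INF a\<in>A. f a)"
    using assms by (intro cINF_greatest) (auto simp: field_simps)
  then show ?thesis
    using \<open>c > 0\<close> by (simp add: field_simps)
qed

lemma sublinear_chain_INF:
  assumes "\<C> \<noteq> {}" and sub: "\<And>m. m \<in> \<C> \<Longrightarrow> sublinear m" and "\<And>m. m \<in> \<C> \<Longrightarrow> m \<le> p"
    and chain: "\<And>m m'. m \<in> \<C> \<Longrightarrow> m' \<in> \<C> \<Longrightarrow> m \<le> m' \<or> m' \<le> m"
  shows "sublinear (\<lambda>x. INF m\<in>\<C>. m x)"
    and "\<And>m x. m \<in> \<C> \<Longrightarrow> (INF m\<in>\<C>. m x) \<le> m x"
proof -
  have bdd: "bdd_below ((\<lambda>m. m x) ` \<C>)" for x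
  proof (rule bdd_belowI2)
    fix m assume "m \<in> \<C>"
    then have "m (- x) \<le> p (- x)" "- m (- x) \<le> m x"
      using assms(3) sublinear_minus[OF sub] by (auto simp: le_fun_def)
    then show "- p (- x) \<le> m x" by linarith
  qed
  show lower: "(INF m\<in>\<C>. m x) \<le> m x" if "m \<in> \<C>" for m x
    by (rule cINF_lower[OF bdd that])
  show "sublinear (\<lambda>x. INF m\<in>\<C>. m x)"
  proof (rule sublinearI)
    fix x y
    show "(INF m\<in>\<C>. m (x + y)) \<le> (INF m\<in>\<C>. m x) + (INF m\<in>\<C>. m y)"
    proof (rule le_cINF_add)
      fix m m' assume m: "m \<in> \<C>" "m' \<in> \<C>"
      \<comment> \<open>The two infima range over independent members, so the smaller of
        \<open>m\<close> and \<open>m'\<close> serves both.\<close>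
      then obtain h where h: "h \<in> \<C>" "h \<le> m" "h \<le> m'"
        using chain by blast
      have "(INF m\<in>\<C>. m (x + y)) \<le> h (x + y)" by (rule lower[OF h(1)])
      also have "\<dots> \<le> h x + h y" by (rule sublinear_add[OF sub[OF h(1)]])
      also have "\<dots> \<le> m x + m' y" using h by (intro add_mono) (auto simp: le_fun_def)
      finally show "(INF m\<in>\<C>. m (x + y)) \<le> m x + m' y" .
    qed (use assms in auto)
  next
    fix c :: real and x assume "c > 0"
    then show "(INF m\<in>\<C>. m (c *\<^sub>R x)) \<le> c * (INF m\<in>\<C>. m x)"
      using lower sub by (intro le_mult_cINF assms) (auto simp flip: sublinear_scaleR)
  qed
qed

text \<open>Zorn's lemma for the reversed pointwise order: a nonempty chain is bounded by its
  pointwise infimum, the empty one by \<open>p\<close>.\<close>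

lemma minimal_sublinear_exists:
  assumes "sublinear p"
  obtains m where "sublinear m" "m \<le> p" "\<And>q. sublinear q \<Longrightarrow> q \<le> m \<Longrightarrow> q = m"
proof -
  let ?S = "{m. sublinear m \<and> m \<le> p}"
  have "\<exists>m\<in>?S. \<forall>q\<in>?S. q \<le> m \<longrightarrow> q = m"
  proof (rule predicate_Zorn)
    show "partial_order_on ?S (relation_of (\<lambda>a b. b \<le> a) ?S)"
      by (rule partial_order_on_relation_ofI) auto
  next
    fix \<C> assume \<C>: "\<C> \<in> Chains (relation_of (\<lambda>a b. b \<le> a) ?S)"
    show "\<exists>u\<in>?S. \<forall>a\<in>\<C>. u \<le> a"
    proof (cases "\<C> = {}")
      case True
      then show ?thesis using assms by auto
    next
      case False
      have sub: "\<And>m. m \<in> \<C> \<Longrightarrow> sublinear m" and le: "\<And>m. m \<in> \<C> \<Longrightarrow> m \<le> p"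
        and chain: "\<And>m m'. m \<in> \<C> \<Longrightarrow> m' \<in> \<C> \<Longrightarrow> m \<le> m' \<or> m' \<le> m"
        using \<C> by (auto simp: Chains_def relation_of_def)
      note inf = sublinear_chain_INF[OF False sub le chain]
      obtain m where "m \<in> \<C>" using False by blast
      then have "(\<lambda>x. INF m\<in>\<C>. m x) \<le> m" "m \<le> p"
        using inf(2) le by (auto simp: le_fun_def)
      then have "(\<lambda>x. INF m\<in>\<C>. m x) \<le> p"
        by (rule order_trans)
      then show ?thesis
        using inf by (intro bexI[of _ "\<lambda>x. INF m\<in>\<C>. m x"]) (auto simp: le_fun_def)
    qed
  qed
  then show ?thesis
    using that order_trans by blast
qed

text \<open>A linear \<open>f \<le> m\<close> with \<open>r \<le> f k\<close> on \<open>K\<close>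
  satisfies \<open>f z \<le> m (z + k) - r\<close>, which suggests the infimum of the right-hand
  sides. Sums in \<open>K\<close> make it subadditive, scaling makes it homogeneous.\<close>

lemma sublinear_lower_along_cone:
  fixes K :: "('a::real_vector \<times> real) set"
  assumes m: "sublinear m" and K: "convex_cone K" and le: "\<And>k r. (k, r) \<in> K \<Longrightarrow> r \<le> m k"
  obtains q where "sublinear q" "q \<le> m" "\<And>k r z. (k, r) \<in> K \<Longrightarrow> q z \<le> m (z + k) - r"
proof -
  let ?h = "\<lambda>z w. m (z + fst w) - snd w"
  define q where "q z = (INF w\<in>K. ?h z w)" for z
  have ne: "K \<noteq> {}"
    using convex_cone_nonempty[OF K] .
  \<comment> \<open>Since \<open>K\<close> lies below the graph of \<open>m\<close>, these values
    are at least \<open>- m (- z)\<close>.\<close>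
  have "bdd_below (?h z ` K)" for z
  proof (rule bdd_belowI2)
    fix w assume "w \<in> K"
    then have "snd w \<le> m (z + fst w + - z)"
      using le[of "fst w" "snd w"] by simp
    also have "\<dots> \<le> m (z + fst w) + m (- z)"
      by (rule sublinear_add[OF m])
    finally show "- m (- z) \<le> ?h z w" by simp
  qed
  then have lower: "q z \<le> ?h z w" if "w \<in> K" for z w
    unfolding q_def using that by (rule cINF_lower)
  show ?thesis
  proof (rule that)
    show "sublinear q"
    proof (rule sublinearI)
      fix x y
      show "q (x + y) \<le> q x + q y"
        unfolding q_def[of x] q_def[of y]
      proof (rule le_cINF_add)
        fix a b assume "a \<in> K" "b \<in> K"
        then have "q (x + y) \<le> ?h (x + y) (a + b)"
          by (intro lower convex_cone_add[OF K])
        also have "\<dots> \<le> ?h x a + ?h y b"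
          using sublinear_add[OF m, of "x + fst a" "y + fst b"] by (simp add: algebra_simps)
        finally show "q (x + y) \<le> ?h x a + ?h y b" .
      qed (use ne in auto)
    next
      fix c :: real and x assume c: "c > 0"
      show "q (c *\<^sub>R x) \<le> c * q x"
        unfolding q_def[of x]
      proof (rule le_mult_cINF[OF ne c])
        fix a assume "a \<in> K"
        then have "q (c *\<^sub>R x) \<le> ?h (c *\<^sub>R x) (c *\<^sub>R a)"
          using c by (intro lower convex_cone_scaleR[OF K]) auto
        also have "\<dots> = c * ?h x a"
          using sublinear_scaleR[OF m, of c "x + fst a"] c by (simp add: algebra_simps)
        finally show "q (c *\<^sub>R x) \<le> c * ?h x a" .
      qed
    qed
    show "q \<le> m"
      using lower[OF convex_cone_contains_0[OF K]] by (simp add: le_fun_def)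
    show "q z \<le> m (z + k) - r" if "(k, r) \<in> K" for k r z
      using lower[OF that] by simp
  qed
qed

lemma convex_cone_conic_hull:
  assumes "convex S" "S \<noteq> {}"
  shows "convex_cone (conic hull S)"
  using assms hull_subset[of S conic]
  by (auto simp: convex_cone_def convex_conic_hull conic_conic_hull)

lemma minimal_sublinear_linear:
  fixes m :: "'a::real_vector \<Rightarrow> real"
  assumes m: "sublinear m" and min: "\<And>q. sublinear q \<Longrightarrow> q \<le> m \<Longrightarrow> q = m"
  shows "linear m"
proof -
  have add: "m (x + y) = m x + m y" for x y
  proof -
    let ?K = "conic hull {(y, m y)}"
    have "r \<le> m k" if "(k, r) \<in> ?K" for k r
      using that by (auto simp: conic_hull_explicit sublinear_scaleR[OF m])
    moreover have "convex_cone ?K"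
      by (rule convex_cone_conic_hull) auto
    ultimately obtain q where q: "sublinear q" "q \<le> m"
      "\<And>k r z. (k, r) \<in> ?K \<Longrightarrow> q z \<le> m (z + k) - r"
      using sublinear_lower_along_cone[OF m] by metis
    have "(y, m y) \<in> ?K"
      by (simp add: hull_inc)
    \<comment> \<open>Minimality turns \<open>q\<close> into \<open>m\<close>, and the bound becomes
      superadditivity.\<close>
    from q(3)[OF this, of x] have "m x \<le> m (x + y) - m y"
      using min[OF q(1,2)] by simp
    then show ?thesis
      using sublinear_add[OF m, of x y] by simp
  qed
  have neg: "m (- x) = - m x" for x
    using add[of x "- x"] sublinear_zero[OF m] by simp
  have "m (c *\<^sub>R x) = c * m x" for c x
  proof (cases "c \<ge> 0")
    case False
    then have "m (- ((- c) *\<^sub>R x)) = c * m x"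
      unfolding neg using sublinear_scaleR[OF m, of "- c" x] by simp
    then show ?thesis by simp
  qed (rule sublinear_scaleR[OF m])
  with add show ?thesis
    by (intro linearI) auto
qed

section \<open>The Hahn-Banach theorem and separation of a point\<close>

lemma Hahn_Banach_cone:
  fixes K :: "('a::real_vector \<times> real) set"
  assumes "sublinear p" "convex_cone K" "\<And>k r. (k, r) \<in> K \<Longrightarrow> r \<le> p k"
  obtains f where "linear f" "\<And>x. f x \<le> p x" "\<And>k r. (k, r) \<in> K \<Longrightarrow> r \<le> f k"
proof -
  obtain q where q: "sublinear q" "q \<le> p" "\<And>k r z. (k, r) \<in> K \<Longrightarrow> q z \<le> p (z + k) - r"
    using sublinear_lower_along_cone[OF assms] by metis
  obtain f where f: "sublinear f" "f \<le> q" "\<And>q'. sublinear q' \<Longrightarrow> q' \<le> f \<Longrightarrow> q' = f"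
    using minimal_sublinear_exists[OF q(1)] by metis
  have lin: "linear f"
    by (rule minimal_sublinear_linear[OF f(1,3)])
  show ?thesis
  proof (rule that[OF lin])
    show "f x \<le> p x" for x
      using f(2) q(2) by (auto simp: le_fun_def intro: order_trans)
    show "r \<le> f k" if "(k, r) \<in> K" for k r
    proof -
      \<comment> \<open>By linearity an upper bound at \<open>- k\<close> is a lower bound at
        \<open>k\<close>.\<close>
      have "f (- k) \<le> q (- k)" using f(2) by (simp add: le_fun_def)
      also have "\<dots> \<le> p (- k + k) - r" by (rule q(3)[OF that])
      finally show ?thesis
        using sublinear_zero[OF assms(1)] linear_neg[OF lin, of k] by simp
    qed
  qed
qed

lemma separating_functional_point_convex:
  fixes z :: "'a::real_normed_vector"
  assumes "convex S" "S \<noteq> {}" "z \<notin> closure S"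
  obtains F :: "'a \<Rightarrow>\<^sub>L real" and d where "d > 0" "\<And>s. s \<in> S \<Longrightarrow> F s \<le> F z - d"
proof -
  obtain d where d: "d > 0" "\<And>s. s \<in> S \<Longrightarrow> d \<le> norm (z - s)"
    using assms(3) by (force simp: closure_approachable dist_norm norm_minus_commute not_less)
  \<comment> \<open>At height \<open>d\<close> the cone lies below the graph of the norm, and a
    linear \<open>f\<close> above the cone satisfies \<open>d \<le> f (z - s)\<close>.\<close>
  let ?C = "(\<lambda>s. z - s) ` S \<times> {d}"
  have "convex ?C"
    using convex_translation[OF convex_negations[OF assms(1)], of z]
    by (intro convex_Times) (auto simp: image_image)
  then have "convex_cone (conic hull ?C)"
    using assms(2) by (intro convex_cone_conic_hull) auto
  moreover have "r \<le> norm k" if "(k, r) \<in> conic hull ?C" for k r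
    using that d(2) by (auto simp: conic_hull_explicit mult_left_mono)
  ultimately obtain f where f: "linear f" "\<And>x. f x \<le> norm x"
    "\<And>k r. (k, r) \<in> conic hull ?C \<Longrightarrow> r \<le> f k"
    using Hahn_Banach_cone[OF sublinear_norm] by metis
  have "\<bar>f x\<bar> \<le> norm x" for x
    using f(2)[of x] f(2)[of "- x"] linear_neg[OF f(1), of x] by simp
  then have "bounded_linear f"
    using f(1) by (intro bounded_linear_intro[where K = 1]) (auto simp: linear_add linear_cmul)
  then have app: "blinfun_apply (Blinfun f) = f"
    by (rule bounded_linear_Blinfun_apply)
  show ?thesis
  proof (rule that[OF d(1)])
    fix s assume "s \<in> S"
    then have "d \<le> f (z - s)"
      by (intro f(3) hull_inc) auto
    then show "Blinfun f s \<le> Blinfun f z - d"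
      unfolding app using linear_diff[OF f(1)] by simp
  qed
qed

text \<open>Otherwise \<open>norm f - \<eta>\<close> would bound \<open>f\<close> on unit vectors
  and so, by scaling, be an operator bound below the norm.\<close>

lemma norm_blinfun_almost_attained:
  fixes f :: "'a::real_normed_vector \<Rightarrow>\<^sub>L real"
  assumes "\<eta> > 0"
  obtains v where "v \<in> cball 0 1" "f v > norm f - \<eta>"
proof (rule ccontr)
  assume "\<not> thesis"
  then have le: "f v \<le> norm f - \<eta>" if "norm v \<le> 1" for v
    using that \<open>\<And>v. v \<in> cball 0 1 \<Longrightarrow> f v > norm f - \<eta> \<Longrightarrow> thesis\<close>[of v] by fastforce
  have "norm (f v) \<le> (norm f - \<eta>) * norm v" for v
  proof (cases "v = 0")
    case False
    have "f (sgn v) \<le> norm f - \<eta>" "f (- sgn v) \<le> norm f - \<eta>"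
      by (intro le; simp add: norm_sgn)+
    then have "\<bar>f (sgn v)\<bar> \<le> norm f - \<eta>"
      by (simp add: blinfun.minus_right)
    then show ?thesis
      using False by (simp add: sgn_div_norm blinfun.scaleR_right abs_mult field_simps)
  qed (simp add: blinfun.zero_right)
  moreover have "0 \<le> norm f - \<eta>"
    using le[of 0] by (simp add: blinfun.zero_right)
  ultimately have "norm f \<le> norm f - \<eta>"
    using norm_blinfun_bound by blast
  then show False using assms by simp
qed

section \<open>Delta points of the sum\<close>

lemma bounded_linear_lfst: "bounded_linear lfst" and bounded_linear_lsnd: "bounded_linear lsnd"
  by (auto intro!: bounded_linear_intro[where K = 1] simp: norm_lfst_le norm_lsnd_le)

lemma bounded_linear_LinfPair_left: "bounded_linear (\<lambda>u. LinfPair u 0)"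
  and bounded_linear_LinfPair_right: "bounded_linear (\<lambda>v. LinfPair 0 v)"
  by (auto intro!: bounded_linear_intro[where K = 1]
      simp: plus_linf_sum_def scaleR_linf_sum_def)

lemma LinfPair_diff [simp]: "LinfPair x y - LinfPair u v = LinfPair (x - u) (y - v)"
  by (simp add: minus_linf_sum_def)

text \<open>The summands are the restrictions of \<open>F\<close> to the coordinate axes.\<close>

lemma blinfun_linf_sum_decompose:
  fixes F :: "('a::real_normed_vector, 'b::real_normed_vector) linf_sum \<Rightarrow>\<^sub>L real"
  obtains f g where "\<And>u v. blinfun_apply F (LinfPair u v) = blinfun_apply f u + blinfun_apply g v"
proof (rule that)
  fix u :: 'a and v :: 'b
  have "LinfPair u v = LinfPair u 0 + LinfPair 0 v"
    by (simp add: plus_linf_sum_def)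
  then show "blinfun_apply F (LinfPair u v) = Blinfun (\<lambda>u. blinfun_apply F (LinfPair u 0)) u + Blinfun (\<lambda>v. blinfun_apply F (LinfPair 0 v)) v"
    by (simp add: blinfun.add_right bounded_linear_Blinfun_apply blinfun.bounded_linear_right
        bounded_linear_compose[OF _ bounded_linear_LinfPair_left]
        bounded_linear_compose[OF _ bounded_linear_LinfPair_right])
qed

section \<open>Part (a): slices of arbitrary functionals\<close>

lemma delta_k_point_functional:
  fixes f :: "'a::real_normed_vector \<Rightarrow>\<^sub>L real"
  assumes x: "delta_k_point k x" and "k > 0" "\<epsilon> > 0" and a: "a > norm f - f x"
  obtains u where "u \<in> cball 0 1" "norm (x - u) \<ge> 2 - \<epsilon>" "f u > norm f - k * a"
proof -
  have nx: "norm x = 1"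
    using x by (simp add: delta_k_point_def)
  have "f x \<le> norm f"
    using norm_blinfun[of f x] nx by simp
  then have "a > 0" using a by simp
  show ?thesis
  proof (cases "f = 0")
    case True
    \<comment> \<open>The zero functional cannot be normalised; here the antipode \<open>- x\<close>
      serves, as \<open>k * a > 0\<close>.\<close>
    have "norm (x - - x) = 2"
      using nx norm_scaleR[of 2 x] by (simp add: scaleR_2)
    then show ?thesis
      using that[of "- x"] nx True \<open>a > 0\<close> assms by simp
  next
    case False
    then have n: "norm f > 0" by simp
    \<comment> \<open>Normalising \<open>f\<close> rescales the slice width \<open>a\<close> to
      \<open>a / norm f\<close>; the strict bound on \<open>a\<close> puts \<open>x\<close> into the
      slice.\<close>
    let ?g = "inverse (norm f) *\<^sub>R f"
    have "(norm f - a) / norm f < f x / norm f"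
      using a n by (intro divide_strict_right_mono) auto
    then have "1 - a / norm f < inverse (norm f) * f x"
      using n by (simp add: diff_divide_distrib divide_inverse_commute[of "f x"])
    then have "?g \<in> sphere 0 1" "a / norm f > 0" "x \<in> ball_slice ?g (a / norm f)"
      using n nx \<open>a > 0\<close> by (auto simp: ball_slice_def blinfun.scaleR_left)
    then obtain u where "u \<in> ball_slice ?g (k * (a / norm f))" "norm (x - u) \<ge> 2 - \<epsilon>"
      using x \<open>\<epsilon> > 0\<close> unfolding delta_k_point_def by meson
    then show ?thesis
      using n by (intro that[of u]) (auto simp: ball_slice_def blinfun.scaleR_left field_simps)
  qed
qed

text \<open>Distance is demanded of \<open>u\<close> alone, so \<open>v\<close> is free to nearly
  attain the norm of \<open>g\<close>.\<close>

lemma delta_k_point_functional_sum: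
  fixes f :: "'a::real_normed_vector \<Rightarrow>\<^sub>L real" and g :: "'b::real_normed_vector \<Rightarrow>\<^sub>L real"
  assumes "delta_k_point k x" "k > 0" "\<epsilon> > 0" "d > 0"
  obtains u v where "u \<in> cball 0 1" "v \<in> cball 0 1" "norm (x - u) \<ge> 2 - \<epsilon>"
    "f u + g v > norm f + norm g - k * (norm f - f x) - d"
proof -
  \<comment> \<open>The error \<open>\<eta>\<close> enters once through \<open>v\<close> and
    \<open>k\<close> times through the slice, in total \<open>d\<close>.\<close>
  define \<eta> where "\<eta> = d / (k + 1)"
  have "(k + 1) * \<eta> = d"
    using assms by (simp add: \<eta>_def)
  then have \<eta>: "k * \<eta> + \<eta> = d"
    by (simp add: distrib_right)
  have \<eta>_pos: "\<eta> > 0"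
    using assms by (simp add: \<eta>_def)
  obtain u where u: "u \<in> cball 0 1" "norm (x - u) \<ge> 2 - \<epsilon>"
    "f u > norm f - k * (norm f - f x + \<eta>)"
    using delta_k_point_functional[OF assms(1-3), where a = "norm f - f x + \<eta>" and f = f] \<eta>_pos
    by auto
  obtain v where v: "v \<in> cball 0 1" "g v > norm g - \<eta>"
    using norm_blinfun_almost_attained[OF \<eta>_pos] by metis
  have "f u + g v > norm f + norm g - k * (norm f - f x) - (k * \<eta> + \<eta>)"
    using u v by (simp add: algebra_simps)
  then show ?thesis
    using that u v \<eta> by simp
qed

lemma delta_point_LinfPair:
  fixes x :: "'a::real_normed_vector" and y :: "'b::real_normed_vector"
  assumes x: "delta_k_point p x" and y: "delta_k_point q y"
    and p: "p > 0" and q: "q > 0" and pq: "1 / p + 1 / q = 1"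
  shows "delta_point (LinfPair x y)"
proof -
  have nx: "norm x = 1" and ny: "norm y = 1"
    using x y by (auto simp: delta_k_point_def)
  have "LinfPair x y \<in> closure (convex hull far_set \<epsilon> (LinfPair x y))" if \<epsilon>: "\<epsilon> > 0" for \<epsilon>
  proof (rule ccontr)
    let ?S = "far_set \<epsilon> (LinfPair x y)"
    assume notin: "LinfPair x y \<notin> closure (convex hull ?S)"
    have far: "LinfPair u v \<in> ?S"
      if "u \<in> cball 0 1" "v \<in> cball 0 1" "norm (x - u) \<ge> 2 - \<epsilon> \<or> norm (y - v) \<ge> 2 - \<epsilon>" for u v
      using that by (auto simp: far_set_def)
    have "norm (x - - x) = 2"
      using nx norm_scaleR[of 2 x] by (simp add: scaleR_2)
    then have "LinfPair (- x) 0 \<in> ?S"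
      using nx \<epsilon> by (intro far) auto
    then have "convex hull ?S \<noteq> {}"
      by auto
    then obtain F :: "('a, 'b) linf_sum \<Rightarrow>\<^sub>L real" and d where d: "d > 0"
      and "\<And>s. s \<in> convex hull ?S \<Longrightarrow> blinfun_apply F s \<le> F (LinfPair x y) - d"
      using separating_functional_point_convex[OF convex_convex_hull _ notin] by metis
    then have F: "\<And>s. s \<in> ?S \<Longrightarrow> F s \<le> F (LinfPair x y) - d"
      by (simp add: hull_inc)
    obtain f g where fg: "\<And>u v. F (LinfPair u v) = blinfun_apply f u + blinfun_apply g v"
      using blinfun_linf_sum_decompose by metis
    \<comment> \<open>\<open>F (LinfPair x y)\<close> equals \<open>norm f + norm g - A - B\<close>;
      the error \<open>d\<close> allowed below cancels the separation gap \<open>d\<close>.\<close>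
    define A B where "A = norm f - f x" and "B = norm g - g y"
    obtain u v where "u \<in> cball 0 1" "v \<in> cball 0 1" "norm (x - u) \<ge> 2 - \<epsilon>"
      "f u + g v > norm f + norm g - p * A - d"
      using delta_k_point_functional_sum[OF x p \<epsilon> d] unfolding A_def by metis
    with F[OF far, of u v] have "A + B < p * A"
      by (simp add: fg A_def B_def)
    then have 1: "(A + B) * (1 / p) < A"
      using p by (simp add: field_simps)
    obtain v u where "v \<in> cball 0 1" "u \<in> cball 0 1" "norm (y - v) \<ge> 2 - \<epsilon>"
      "g v + f u > norm g + norm f - q * B - d"
      using delta_k_point_functional_sum[OF y q \<epsilon> d] unfolding B_def by metis
    with F[OF far, of u v] have "A + B < q * B"
      by (simp add: fg A_def B_def)
    then have 2: "(A + B) * (1 / q) < B"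
      using q by (simp add: field_simps)
    have "(A + B) * (1 / p + 1 / q) < A + B"
      using 1 2 by (simp add: distrib_left)
    then show False
      by (simp add: pq)
  qed
  then show ?thesis
    using nx ny by (simp add: delta_point_def)
qed

section \<open>Part (b): a half-space separating the pair from its far set\<close>

lemma not_delta_k_pointE:
  assumes "\<not> delta_k_point k x" "x \<in> sphere 0 1"
  obtains f \<alpha> \<epsilon> where "norm f = 1" "\<alpha> > 0" "\<epsilon> > 0" "blinfun_apply f x > 1 - \<alpha>"
    "\<And>u. norm u \<le> 1 \<Longrightarrow> norm (x - u) \<ge> 2 - \<epsilon> \<Longrightarrow> f u \<le> 1 - k * \<alpha>"
  using assms unfolding delta_k_point_def ball_slice_def by (force simp: not_less)

lemma not_delta_point_LinfPair:
  fixes x :: "'a::real_normed_vector" and y :: "'b::real_normed_vector"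
  assumes x: "\<not> delta_k_point p x" "x \<in> sphere 0 1" and y: "\<not> delta_k_point q y" "y \<in> sphere 0 1"
    and p: "p > 0" and q: "q > 0" and pq: "1 / p + 1 / q = 1"
  shows "\<not> delta_point (LinfPair x y)"
proof
  assume delta: "delta_point (LinfPair x y)"
  obtain f \<alpha> \<epsilon> where f: "norm f = 1" "\<alpha> > 0" "\<epsilon> > 0" "blinfun_apply f x > 1 - \<alpha>"
    "\<And>u. norm u \<le> 1 \<Longrightarrow> norm (x - u) \<ge> 2 - \<epsilon> \<Longrightarrow> f u \<le> 1 - p * \<alpha>"
    using not_delta_k_pointE[OF x] by metis
  obtain g \<beta> \<delta> where g: "norm g = 1" "\<beta> > 0" "\<delta> > 0" "blinfun_apply g y > 1 - \<beta>"
    "\<And>v. norm v \<le> 1 \<Longrightarrow> norm (y - v) \<ge> 2 - \<delta> \<Longrightarrow> g v \<le> 1 - q * \<beta>"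
    using not_delta_k_pointE[OF y] by metis
  have f1: "f u \<le> 1" if "norm u \<le> 1" for u
    using norm_blinfun[of f u] f(1) that by simp
  have g1: "g v \<le> 1" if "norm v \<le> 1" for v
    using norm_blinfun[of g v] g(1) that by simp
  \<comment> \<open>The weights turn both losses \<open>p * \<alpha>\<close> and \<open>q * \<beta>\<close> into a loss of 1,
    while at \<open>(x, y)\<close> the loss stays below \<open>1 / p + 1 / q = 1\<close>.\<close>
  define s t where "s = 1 / (p * \<alpha>)" and "t = 1 / (q * \<beta>)"
  have st: "s > 0" "t > 0" "s * (p * \<alpha>) = 1" "t * (q * \<beta>) = 1" "s * \<alpha> = 1 / p" "t * \<beta> = 1 / q"
    using p q f g by (auto simp: s_def t_def)
  define h where "h w = s * f (lfst w) + t * g (lsnd w)" for w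
  have h: "bounded_linear h"
    unfolding h_def
    by (intro bounded_linear_add bounded_linear_const_mult
        bounded_linear_compose[OF blinfun.bounded_linear_right] bounded_linear_lfst bounded_linear_lsnd)
  \<comment> \<open>On the unit ball \<open>h\<close> is at most \<open>s + t\<close>; the
    half-space is cut at a loss of 1.\<close>
  let ?H = "h -` {.. s + t - 1}"
  have "closed ?H" "convex ?H"
    using h by (auto intro!: continuous_closed_vimage linear_continuous_at convex_linear_vimage
        bounded_linear.linear)
  moreover have "far_set (min \<epsilon> \<delta>) (LinfPair x y) \<subseteq> ?H"
  proof
    fix w assume w: "w \<in> far_set (min \<epsilon> \<delta>) (LinfPair x y)"
    obtain u v where uv: "w = LinfPair u v" by (cases w)
    \<comment> \<open>In the max norm a far pair has a far coordinate, and the minimum respects both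
      thresholds.\<close>
    have n: "norm u \<le> 1" "norm v \<le> 1"
      and "norm (x - u) \<ge> 2 - \<epsilon> \<or> norm (y - v) \<ge> 2 - \<delta>"
      using w by (auto simp: far_set_def uv)
    then consider "f u \<le> 1 - p * \<alpha>" | "g v \<le> 1 - q * \<beta>"
      using f(5) g(5) by blast
    then show "w \<in> ?H"
    proof cases
      case 1
      then have "s * f u + t * g v \<le> s * (1 - p * \<alpha>) + t * 1"
        using st g1 n by (intro add_mono mult_left_mono) auto
      then show ?thesis
        using st by (simp add: h_def uv right_diff_distrib)
    next
      case 2
      then have "s * f u + t * g v \<le> s * 1 + t * (1 - q * \<beta>)"
        using st f1 n by (intro add_mono mult_left_mono) auto
      then show ?thesis
        using st by (simp add: h_def uv right_diff_distrib)
    qed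
  qed
  ultimately have "closure (convex hull far_set (min \<epsilon> \<delta>) (LinfPair x y)) \<subseteq> ?H"
    by (intro closure_minimal hull_minimal)
  moreover have "LinfPair x y \<in> closure (convex hull far_set (min \<epsilon> \<delta>) (LinfPair x y))"
    using delta f(3) g(3) by (simp add: delta_point_def)
  ultimately have "h (LinfPair x y) \<le> s + t - 1"
    by blast
  \<comment> \<open>Hence \<open>h (LinfPair x y)\<close> exceeds
    \<open>s + t - (1 / p + 1 / q)\<close>, which is \<open>s + t - 1\<close>.\<close>
  moreover have "s * (1 - \<alpha>) < s * f x" "t * (1 - \<beta>) < t * g y"
    using f g st by auto
  ultimately show False
    using st pq by (simp add: h_def right_diff_distrib)
qed

theorem proposition4p4:
  fixes x :: "'a::banach" and y :: "'b::banach" and p q :: real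
  assumes "x \<in> sphere 0 1" and "y \<in> sphere 0 1"
    and "p > 1" and "q > 1" and "1 / p + 1 / q = 1"
  shows "(delta_k_point p x \<and> delta_k_point q y \<longrightarrow> delta_point (LinfPair x y)) \<and>
    (\<not> delta_k_point p x \<and> \<not> delta_k_point q y \<longrightarrow> \<not> delta_point (LinfPair x y))"
  using assms delta_point_LinfPair[of p x q y] not_delta_point_LinfPair[of p x q y] by auto

end
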